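(* For any finite coloring of $\mathbb{N}$ there exist $a,b,c\in\mathbb{N}$, all of the same color, such that $a^2-b^2=c$.
   Context: $\mathbb{N}=\{1,2,\dots\}$. A finite coloring of $\mathbb{N}$ is a finite partition $\mathbb{N}=C_1\cup\cdots\cup C_r$; numbers have the same color if they lie in the same cell. *)

theory Defs
  imports Complex_Main "HOL-Library.Disjoint_Sets"
begin

end

theory Submission
  imports Defs
begin

text \<open>
  Since \<open>(x + y)\<^sup>2 - (x - y)\<^sup>2 = 4 * x * y\<close>, it suffices to find \<open>x\<close> and \<open>y\<close> such that
  \<open>x + y\<close>, \<open>x - y\<close> and \<open>4 * x * y\<close> have the same color.  The argument follows Moreira's
  proof that sums and products \<open>{x + y, x * y}\<close> can be made monochromatic.

  A set of integers counts as large if it is piecewise syndetic.  Three facts about large sets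
  are used: if a finite union is large, so is one of its parts (\<open>large_UN\<close>); dilations
  preserve largeness (\<open>large_dilate\<close>); and for every large \<open>B\<close> and every bound \<open>k\<close>
  there is one step \<open>z > 0\<close> for which the set of all \<open>m\<close> with \<open>m + c * z \<in> B\<close>
  for \<open>\<bar>c\<bar> \<le> k\<close> is large again (\<open>large_symmetric_progression\<close>, van der Waerden's
  theorem for piecewise syndetic sets).

  Starting from a large color class \<open>B\<^sub>0\<close>, one passes repeatedly from \<open>B\<close> to the set of
  centers of its progressions of step \<open>z\<close>, dilates this set by \<open>4 * z\<close>, and keeps a color
  in which the result is still large.  Two stages \<open>i < j\<close> have the same color.  Every
  element of \<open>B\<^sub>j\<close> has the form \<open>4 * x * y\<close>, where \<open>x \<in> B\<^sub>i\<close> and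
  \<open>4 * y\<close> is the product of the dilation factors used in between.  The last progression,
  divided by the other dilation factors, has its center at \<open>x\<close>, and its coefficients can be
  chosen such that it contains \<open>x + y\<close> and \<open>x - y\<close>, which then lie in \<open>B\<^sub>i\<close> as well.
\<close>

section \<open>Piecewise syndetic sets\<close>

text \<open>
  Piecewise syndetic: with gaps at most \<open>M\<close> on arbitrarily long intervals.  The intervals are
  moreover required to lie in \<open>T\<close>.  This relative form is what the proof of van der Waerden's
  theorem below needs: finitely many translates of a large set \<open>A\<close> in general cover only
  a union of ever longer intervals, and the induction has to stay inside this union.
\<close>

definition large :: "int set \<Rightarrow> int set \<Rightarrow> bool" where
  "large T A \<longleftrightarrow>
    (\<exists>M::nat. \<forall>L::nat. \<exists>s. \<forall>n\<in>{s..s + int L}. n \<in> T \<and> (\<exists>a\<in>A. n \<le> a \<and> a \<le> n + int M))"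

lemma large_mono:
  assumes "large T A" "T \<subseteq> T'" "A \<subseteq> A'"
  shows "large T' A'"
proof -
  obtain M :: nat where M: "\<And>L::nat. \<exists>s. \<forall>n\<in>{s..s + int L}. n \<in> T \<and> (\<exists>a\<in>A. n \<le> a \<and> a \<le> n + int M)"
    using assms(1) unfolding large_def by blast
  have "\<exists>s. \<forall>n\<in>{s..s + int L}. n \<in> T' \<and> (\<exists>a\<in>A'. n \<le> a \<and> a \<le> n + int M)" for L
    using M[of L] assms(2,3) by (elim exE) blast
  then show ?thesis
    unfolding large_def by blast
qed

lemma large_empty: "\<not> large T {}"
proof
  assume "large T {}"
  then obtain s where "\<forall>n\<in>{s..s + int 0}. False"
    unfolding large_def by blast
  then show False
    by simp
qed

lemma large_Int:
  assumes "large T A"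
  shows "large T (A \<inter> T)"
proof -
  obtain M :: nat where M: "\<And>L::nat. \<exists>s. \<forall>n\<in>{s..s + int L}. n \<in> T \<and> (\<exists>a\<in>A. n \<le> a \<and> a \<le> n + int M)"
    using assms unfolding large_def by blast
  have "\<exists>s. \<forall>n\<in>{s..s + int L}. n \<in> T \<and> (\<exists>a\<in>A \<inter> T. n \<le> a \<and> a \<le> n + int M)" for L
  proof -
    obtain s where s: "\<And>n. n \<in> {s..s + int (L + M)} \<Longrightarrow> n \<in> T \<and> (\<exists>a\<in>A. n \<le> a \<and> a \<le> n + int M)"
      using M[of "L + M"] by blast
    have "n \<in> T \<and> (\<exists>a\<in>A \<inter> T. n \<le> a \<and> a \<le> n + int M)" if n: "n \<in> {s..s + int L}" for n
    proof -
      from s[of n] n obtain a where a: "n \<in> T" "a \<in> A" "n \<le> a" "a \<le> n + int M"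
        by auto
      with s[of a] n have "a \<in> T"
        by auto
      with a show ?thesis
        by blast
    qed
    then show ?thesis
      by blast
  qed
  then show ?thesis
    unfolding large_def by blast
qed

lemma large_shift:
  assumes "large T A"
  shows "large T {m. m + i \<in> A}"
proof -
  obtain M :: nat where M: "\<And>L::nat. \<exists>s. \<forall>n\<in>{s..s + int L}. n \<in> T \<and> (\<exists>a\<in>A. n \<le> a \<and> a \<le> n + int M)"
    using assms unfolding large_def by blast
  define k where "k = nat \<bar>i\<bar>"
  have "\<exists>s. \<forall>n\<in>{s..s + int L}. n \<in> T \<and> (\<exists>a\<in>{m. m + i \<in> A}. n \<le> a \<and> a \<le> n + int (M + k))" for L
  proof -
    obtain s where s: "\<And>n. n \<in> {s..s + int (L + 2 * k)} \<Longrightarrow> n \<in> T \<and> (\<exists>a\<in>A. n \<le> a \<and> a \<le> n + int M)"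
      using M[of "L + 2 * k"] by blast
    have "n \<in> T \<and> (\<exists>a\<in>{m. m + i \<in> A}. n \<le> a \<and> a \<le> n + int (M + k))" if n: "n \<in> {s..s + int L}" for n
    proof -
      have "n \<in> T"
        using s[of n] n by auto
      moreover have "n + i + int k \<in> {s..s + int (L + 2 * k)}"
        using n unfolding k_def by auto
      then obtain a where "a \<in> A" "n + i + int k \<le> a" "a \<le> n + i + int k + int M"
        using s by blast
      then have "a - i \<in> {m. m + i \<in> A}" "n \<le> a - i" "a - i \<le> n + int (M + k)"
        by auto
      ultimately show ?thesis
        by blast
    qed
    then show ?thesis
      by blast
  qed
  then show ?thesis
    unfolding large_def by blast
qed

text \<open>
  If \<open>A\<close> is not large, then windows of any prescribed length that miss \<open>A\<close> recur with
  bounded gaps inside long intervals; where \<open>A \<union> B\<close> has gaps at most \<open>M\<close>, each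
  such window of length \<open>M\<close> has to contain an element of \<open>B\<close>.
\<close>

lemma large_Un:
  assumes "large T (A \<union> B)"
  shows "large T A \<or> large T B"
proof (rule disjCI)
  assume "\<not> large T B"
  obtain M :: nat where M: "\<And>L::nat. \<exists>s. \<forall>n\<in>{s..s + int L}. n \<in> T \<and> (\<exists>a\<in>A \<union> B. n \<le> a \<and> a \<le> n + int M)"
    using assms unfolding large_def by blast
  obtain L' :: nat where L': "\<And>s. \<forall>n\<in>{s..s + int L'}. n \<in> T \<Longrightarrow>
      \<exists>n\<in>{s..s + int L'}. \<forall>a\<in>B. \<not> (n \<le> a \<and> a \<le> n + int M)"
    using \<open>\<not> large T B\<close> unfolding large_def by meson
  have "\<exists>s. \<forall>n\<in>{s..s + int L}. n \<in> T \<and> (\<exists>a\<in>A. n \<le> a \<and> a \<le> n + int (L' + M))" for L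
  proof -
    obtain s where s: "\<And>n. n \<in> {s..s + int (L + L')} \<Longrightarrow> n \<in> T \<and> (\<exists>a\<in>A \<union> B. n \<le> a \<and> a \<le> n + int M)"
      using M[of "L + L'"] by blast
    have "n \<in> T \<and> (\<exists>a\<in>A. n \<le> a \<and> a \<le> n + int (L' + M))" if n: "n \<in> {s..s + int L}" for n
    proof -
      have "\<forall>n'\<in>{n..n + int L'}. n' \<in> T"
        using s n by auto
      then obtain n' where n': "n' \<in> {n..n + int L'}" "\<forall>a\<in>B. \<not> (n' \<le> a \<and> a \<le> n' + int M)"
        using L' by blast
      with n s[of n'] obtain a where "a \<in> A" "n' \<le> a" "a \<le> n' + int M"
        by auto
      moreover from this n' have "n \<le> a" "a \<le> n + int (L' + M)"
        by auto
      moreover have "n \<in> T"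
        using s[of n] n by auto
      ultimately show ?thesis
        by blast
    qed
    then show ?thesis
      by blast
  qed
  then show "large T A"
    unfolding large_def by blast
qed

lemma large_UN:
  assumes "finite I" "large T (\<Union>i\<in>I. A i)"
  shows "\<exists>i\<in>I. large T (A i)"
  using assms
proof (induction I rule: finite_induct)
  case empty
  then show ?case
    by (simp add: large_empty)
next
  case (insert i I)
  then show ?case
    using large_Un[of T "A i" "\<Union>i\<in>I. A i"] by auto
qed

lemma large_dilate:
  assumes "large UNIV A" "c > 0"
  shows "large UNIV ((*) c ` A)"
proof -
  obtain M :: nat where M: "\<And>L::nat. \<exists>s. \<forall>n\<in>{s..s + int L}. \<exists>a\<in>A. n \<le> a \<and> a \<le> n + int M"
    using assms(1) unfolding large_def by blast
  define N where "N = nat (c * (int M + 1))"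
  have N: "int N = c * (int M + 1)"
    using \<open>c > 0\<close> unfolding N_def by simp
  have "\<exists>s. \<forall>n\<in>{s..s + int L}. \<exists>a\<in>(*) c ` A. n \<le> a \<and> a \<le> n + int N" for L
  proof -
    obtain s where s: "\<And>n. n \<in> {s..s + int (L + 1)} \<Longrightarrow> \<exists>a\<in>A. n \<le> a \<and> a \<le> n + int M"
      using M[of "L + 1"] by blast
    have "\<exists>a\<in>(*) c ` A. n \<le> a \<and> a \<le> n + int N" if n: "n \<in> {c * s..c * s + int L}" for n
    proof -
      define q where "q = n div c"
      have q: "c * q \<le> n" "n < c * q + c"
        using \<open>c > 0\<close> pos_mod_bound[of c n] pos_mod_sign[of c n] mult_div_mod_eq[of c n]
        unfolding q_def by linarith+
      have "c * s < c * (q + 1)"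
        using n q by (simp add: algebra_simps)
      then have "s \<le> q"
        using \<open>c > 0\<close> by simp
      moreover have "c * (q - s) \<le> int L"
        using q n by (simp add: algebra_simps)
      then have "q - s \<le> int L"
        using \<open>c > 0\<close> \<open>s \<le> q\<close> mult_right_mono[of 1 c "q - s"] by simp
      ultimately obtain a where a: "a \<in> A" "q + 1 \<le> a" "a \<le> q + 1 + int M"
        using s[of "q + 1"] by auto
      have "c * (q + 1) \<le> c * a" "c * a \<le> c * (q + 1 + int M)"
        using a \<open>c > 0\<close> by (auto intro: mult_left_mono)
      then have "n \<le> c * a" "c * a \<le> n + int N"
        using q unfolding N by (simp_all add: algebra_simps)
      with a show ?thesis
        by blast
    qed
    then show ?thesis
      by blast
  qed
  then show ?thesis
    unfolding large_def by (intro exI[of _ N]) simp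
qed

section \<open>Progressions in piecewise syndetic sets\<close>

lemma finite_range_repeats:
  fixes f :: "nat \<Rightarrow> 'a"
  assumes "finite I" "\<And>n. f n \<in> I"
  shows "\<exists>a b. a < b \<and> f a = f b"
proof -
  have "\<not> inj f"
    using assms finite_imageD[of f UNIV] finite_subset[of "range f" I] by auto
  then show ?thesis
    unfolding inj_def by (metis linorder_neqE_nat)
qed

text \<open>
  Color focusing.  Inside the part \<open>T'\<close> of \<open>T\<close> where \<open>A\<close> has gaps at most
  \<open>M\<close>, the translates \<open>S i\<close> of \<open>A\<close> for \<open>0 \<le> i \<le> M\<close> are
  finitely many colors that cover everything.  The induction hypothesis yields a sequence of
  large sets \<open>B n \<subseteq> S (j n)\<close> and steps such that the \<open>c\<close>-fold steps from
  \<open>B (Suc n)\<close> lead into \<open>B n\<close> for \<open>1 \<le> c \<le> k + 1\<close>.  Steps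
  add up along the sequence, so between two stages of the same color \<open>S i\<close> there is a
  single step \<open>e\<close> with the same property, and the starting point, at \<open>c = 0\<close>, has
  this color as well: this is the additional term of the progression.
\<close>

lemma large_progression:
  assumes "large T A"
  shows "\<exists>d>0. large T {m. \<forall>c\<in>{0..int k}. m + c * d \<in> A}"
  using assms
proof (induction k arbitrary: T A)
  case 0
  then show ?case
    by (auto intro!: exI[of _ 1])
next
  case (Suc k)
  obtain M :: nat where M: "\<And>L::nat. \<exists>s. \<forall>n\<in>{s..s + int L}. n \<in> T \<and> (\<exists>a\<in>A. n \<le> a \<and> a \<le> n + int M)"
    using Suc.prems unfolding large_def by blast
  define T' where "T' = {n \<in> T. \<exists>a\<in>A. n \<le> a \<and> a \<le> n + int M}"
  define I where "I = {0..int M}"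
  define S where "S i = {m. m + i \<in> A}" for i
  have "finite I"
    unfolding I_def by simp
  have "\<exists>s. \<forall>n\<in>{s..s + int L}. n \<in> T' \<and> (\<exists>a\<in>UNIV. n \<le> a \<and> a \<le> n + int 0)" for L
    using M[of L] unfolding T'_def by auto
  then have T': "large T' UNIV"
    unfolding large_def by blast
  have cover: "T' \<subseteq> (\<Union>i\<in>I. S i)"
  proof
    fix n assume "n \<in> T'"
    then obtain a where "a \<in> A" "n \<le> a" "a \<le> n + int M"
      unfolding T'_def by blast
    then show "n \<in> (\<Union>i\<in>I. S i)"
      unfolding I_def S_def by (auto intro!: bexI[of _ "a - n"])
  qed
  have pick: "\<exists>i\<in>I. large T' (X \<inter> S i)" if "large T' X" for X
  proof -
    have "X \<inter> T' \<subseteq> (\<Union>i\<in>I. X \<inter> S i)"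
      using cover by blast
    from large_mono[OF large_Int[OF that] order_refl this] show ?thesis
      by (rule large_UN[OF \<open>finite I\<close>])
  qed
  define P where "P = (\<lambda>(B, i, d::int). large T' B \<and> i \<in> I \<and> B \<subseteq> S i)"
  define Q where "Q = (\<lambda>(B, i::int, d::int) (B', i'::int, d').
    d' > 0 \<and> (\<forall>m\<in>B'. \<forall>c\<in>{1..int k + 1}. m + c * d' \<in> B))"
  have start: "\<exists>t. P t"
    using pick[OF T'] unfolding P_def by fastforce
  have step: "\<exists>t'. P t' \<and> Q t t'" if "P t" for t
  proof -
    obtain B i d where t: "t = (B, i, d)"
      by (cases t) auto
    obtain d' where d': "d' > 0" "large T' {m. \<forall>c\<in>{0..int k}. m + c * d' \<in> B}"
      using Suc.IH[of T' B] \<open>P t\<close> unfolding t P_def by auto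
    define X where "X = {m. \<forall>c\<in>{0..int k}. (m + d') + c * d' \<in> B}"
    have "large T' X"
      using large_shift[OF d'(2), of d'] unfolding X_def by simp
    then obtain i' where i': "i' \<in> I" "large T' (X \<inter> S i')"
      using pick by blast
    have "m + c * d' \<in> B" if "m \<in> X" "c \<in> {1..int k + 1}" for m c
    proof -
      have "(m + d') + (c - 1) * d' \<in> B"
        using that unfolding X_def by auto
      then show ?thesis
        by (simp add: algebra_simps)
    qed
    then have "P (X \<inter> S i', i', d') \<and> Q t (X \<inter> S i', i', d')"
      using i' d' unfolding P_def Q_def t by auto
    then show ?thesis
      by blast
  qed
  obtain f where f: "\<And>n. P (f n)" "\<And>n. Q (f n) (f (Suc n))"
    using dependent_nat_choice[of "\<lambda>_. P" "\<lambda>_. Q"] start step by metis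
  define B where "B n = fst (f n)" for n
  define j where "j n = fst (snd (f n))" for n
  have B: "large T' (B n)" "j n \<in> I" "B n \<subseteq> S (j n)" for n
    using f(1)[of n] unfolding P_def B_def j_def by (auto split: prod.splits)
  have next_step: "\<exists>d>0. \<forall>m\<in>B (Suc n). \<forall>c\<in>{1..int k + 1}. m + c * d \<in> B n" for n
    using f(2)[of n] unfolding Q_def B_def by (auto split: prod.splits)
  have steps: "\<exists>e\<ge>int n. \<forall>m\<in>B (a + n). \<forall>c\<in>{1..int k + 1}. m + c * e \<in> B a" for a n
  proof (induction n)
    case 0
    show ?case
      by (auto intro!: exI[of _ 0])
  next
    case (Suc n)
    then obtain e where e: "e \<ge> int n"
        "\<And>m c. m \<in> B (a + n) \<Longrightarrow> c \<in> {1..int k + 1} \<Longrightarrow> m + c * e \<in> B a"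
      by blast
    obtain d where d: "d > 0"
        "\<And>m c. m \<in> B (Suc (a + n)) \<Longrightarrow> c \<in> {1..int k + 1} \<Longrightarrow> m + c * d \<in> B (a + n)"
      using next_step[of "a + n"] by blast
    have "m + c * (d + e) \<in> B a" if "m \<in> B (a + Suc n)" "c \<in> {1..int k + 1}" for m c
      using e(2)[OF d(2)] that by (simp add: algebra_simps)
    with e(1) d(1) show ?case
      by (intro exI[of _ "d + e"]) auto
  qed
  obtain a b where ab: "a < b" "j a = j b"
    using finite_range_repeats[of I j] B(2) \<open>finite I\<close> by blast
  obtain e where e: "e \<ge> int (b - a)"
      "\<And>m c. m \<in> B b \<Longrightarrow> c \<in> {1..int k + 1} \<Longrightarrow> m + c * e \<in> B a"
    using steps[where a = a and n = "b - a"] \<open>a < b\<close> by auto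
  have "e > 0"
    using e(1) \<open>a < b\<close> by simp
  have "m + c * e \<in> S (j b)" if "m \<in> B b" "c \<in> {0..int (Suc k)}" for m c
  proof (cases "c = 0")
    case True
    then show ?thesis
      using that B(3)[of b] by auto
  next
    case False
    then have "m + c * e \<in> B a"
      using that by (intro e(2)) auto
    then show ?thesis
      using B(3)[of a] ab(2) by auto
  qed
  then have sub: "B b \<subseteq> {m. \<forall>c\<in>{0..int (Suc k)}. m + c * e + j b \<in> A}"
    unfolding S_def by blast
  have "T' \<subseteq> T"
    unfolding T'_def by blast
  then have "large T {m. \<forall>c\<in>{0..int (Suc k)}. m + c * e + j b \<in> A}"
    using large_mono[OF B(1)[of b] _ sub] by blast
  from large_shift[OF this, of "- j b"]
  have "large T {m. \<forall>c\<in>{0..int (Suc k)}. m + c * e \<in> A}"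
    by (simp add: algebra_simps)
  with \<open>e > 0\<close> show ?case
    by blast
qed

lemma large_symmetric_progression:
  assumes "large T A"
  shows "\<exists>d>0. large T {m. \<forall>c. \<bar>c\<bar> \<le> int k \<longrightarrow> m + c * d \<in> A}"
proof -
  obtain d where d: "d > 0" "large T {m. \<forall>c\<in>{0..int (2 * k)}. m + c * d \<in> A}"
    using large_progression[OF assms, of "2 * k"] by blast
  have "{m. m + (- int k * d) \<in> {m. \<forall>c\<in>{0..int (2 * k)}. m + c * d \<in> A}}
      \<subseteq> {m. \<forall>c. \<bar>c\<bar> \<le> int k \<longrightarrow> m + c * d \<in> A}"
  proof safe
    fix m c
    assume "\<forall>c\<in>{0..int (2 * k)}. m + (- int k * d) + c * d \<in> A" and c: "\<bar>c\<bar> \<le> int k"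
    then have "m + (- int k * d) + (c + int k) * d \<in> A"
      by (auto simp: abs_le_iff)
    then show "m + c * d \<in> A"
      by (simp add: algebra_simps)
  qed
  with large_mono[OF large_shift[OF d(2), of "- int k * d"], of T] d(1) show ?thesis
    by blast
qed

section \<open>Monochromatic sums, differences and products\<close>

text \<open>
  The stages carry a set \<open>B n\<close>, its color \<open>j n\<close> and the product \<open>p n\<close> of all
  dilation factors so far.  The quotient \<open>p b div p a\<close> is the factor that leads from
  \<open>B a\<close> to \<open>B b\<close>.  In the step to stage \<open>Suc n\<close>, the coefficient needed for an
  earlier stage \<open>a\<close> is the square of \<open>p n div p a\<close>; it is not known yet which
  \<open>a\<close> will be used, but all these squares are at most \<open>(p n)\<^sup>2\<close>.
\<close>

lemma monochromatic_sum_difference_product: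
  fixes D :: "'i \<Rightarrow> int set"
  assumes "finite I" and cover: "(\<Union>i\<in>I. D i) = {1..}"
  shows "\<exists>i\<in>I. \<exists>x y. x + y \<in> D i \<and> x - y \<in> D i \<and> 4 * x * y \<in> D i"
proof -
  have pick: "\<exists>i\<in>I. large UNIV (X \<inter> D i)" if "large UNIV X" "X \<subseteq> {1..}" for X
  proof -
    have "X \<subseteq> (\<Union>i\<in>I. X \<inter> D i)"
      using cover that(2) by blast
    from large_mono[OF that(1) order_refl this] show ?thesis
      by (rule large_UN[OF \<open>finite I\<close>])
  qed
  define P where "P = (\<lambda>(B, i, p::int). large UNIV B \<and> i \<in> I \<and> B \<subseteq> D i \<and> p > 0)"
  define Q where "Q = (\<lambda>(B, i::'i, p::int) (B', i'::'i, p').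
    \<exists>z>0. p' = 4 * z * p \<and> (\<forall>b\<in>B'. \<exists>m. b = 4 * z * m \<and> (\<forall>c. \<bar>c\<bar> \<le> p\<^sup>2 \<longrightarrow> m + c * z \<in> B)))"
  have "\<forall>n\<in>{1..1 + int L}. n \<in> UNIV \<and> (\<exists>a\<in>{1..}. n \<le> a \<and> a \<le> n + int 0)" for L
    by auto
  then have "large UNIV {1..}"
    unfolding large_def by blast
  then obtain i\<^sub>0 where "i\<^sub>0 \<in> I" "large UNIV ({1..} \<inter> D i\<^sub>0)"
    using pick by blast
  then have start: "P ({1..} \<inter> D i\<^sub>0, i\<^sub>0, 1)"
    unfolding P_def by simp
  have step: "\<exists>t'. P t' \<and> Q t t'" if "P t" for t
  proof -
    obtain B i p where t: "t = (B, i, p)"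
      by (cases t) auto
    have Bip: "large UNIV B" "i \<in> I" "B \<subseteq> D i" "p > 0"
      using \<open>P t\<close> unfolding t P_def by auto
    obtain z where z: "z > 0" "large UNIV {m. \<forall>c. \<bar>c\<bar> \<le> p\<^sup>2 \<longrightarrow> m + c * z \<in> B}"
      using large_symmetric_progression[OF Bip(1), of "nat (p\<^sup>2)"] by auto
    define X where "X = {m. \<forall>c. \<bar>c\<bar> \<le> p\<^sup>2 \<longrightarrow> m + c * z \<in> B}"
    define Y where "Y = (*) (4 * z) ` X"
    have "X \<subseteq> B"
    proof
      fix m assume "m \<in> X"
      then have "m + 0 * z \<in> B"
        unfolding X_def by (metis (mono_tags, lifting) abs_zero mem_Collect_eq zero_le_power2)
      then show "m \<in> B"
        by simp
    qed
    then have "X \<subseteq> {1..}"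
      using Bip cover by blast
    then have "Y \<subseteq> {1..}"
      using z(1) unfolding Y_def by (force simp: int_one_le_iff_zero_less)
    moreover have "large UNIV Y"
      using large_dilate[OF z(2), of "4 * z"] z(1) unfolding Y_def X_def by simp
    ultimately obtain i' where i': "i' \<in> I" "large UNIV (Y \<inter> D i')"
      using pick by blast
    have "P (Y \<inter> D i', i', 4 * z * p)"
      using i' z(1) Bip(4) unfolding P_def by simp
    moreover have "Q t (Y \<inter> D i', i', 4 * z * p)"
      using z(1) unfolding Q_def t Y_def X_def by auto
    ultimately show ?thesis
      by blast
  qed
  obtain f where f: "\<And>n. P (f n)" "\<And>n. Q (f n) (f (Suc n))"
    using dependent_nat_choice[of "\<lambda>_. P" "\<lambda>_. Q"] start step by metis
  define B where "B n = fst (f n)" for n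
  define j where "j n = fst (snd (f n))" for n
  define p where "p n = snd (snd (f n))" for n
  have B: "large UNIV (B n)" "j n \<in> I" "B n \<subseteq> D (j n)" "p n > 0" for n
    using f(1)[of n] unfolding P_def B_def j_def p_def by (auto split: prod.splits)
  have next_step: "\<exists>z>0. p (Suc n) = 4 * z * p n \<and>
      (\<forall>b\<in>B (Suc n). \<exists>m. b = 4 * z * m \<and> (\<forall>c. \<bar>c\<bar> \<le> (p n)\<^sup>2 \<longrightarrow> m + c * z \<in> B n))" for n
    using f(2)[of n] unfolding Q_def B_def p_def by (auto split: prod.splits)
  have descend: "\<exists>q>0. p (a + n) = q * p a \<and> B (a + n) \<subseteq> (*) q ` B a" for a n
  proof (induction n)
    case 0
    show ?case
      by (auto intro!: exI[of _ 1])
  next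
    case (Suc n)
    then obtain q where q: "q > 0" "p (a + n) = q * p a" "B (a + n) \<subseteq> (*) q ` B a"
      by blast
    obtain z where z: "z > 0" "p (Suc (a + n)) = 4 * z * p (a + n)"
        "\<And>b. b \<in> B (Suc (a + n)) \<Longrightarrow>
          \<exists>m. b = 4 * z * m \<and> (\<forall>c. \<bar>c\<bar> \<le> (p (a + n))\<^sup>2 \<longrightarrow> m + c * z \<in> B (a + n))"
      using next_step[of "a + n"] by blast
    have "b \<in> (*) (4 * z * q) ` B a" if b: "b \<in> B (Suc (a + n))" for b
    proof -
      obtain m where m: "b = 4 * z * m" "\<forall>c. \<bar>c\<bar> \<le> (p (a + n))\<^sup>2 \<longrightarrow> m + c * z \<in> B (a + n)"
        using z(3)[OF b] by blast
      from m(2)[rule_format, of 0] have "m \<in> B (a + n)"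
        by simp
      then obtain x where "x \<in> B a" "m = q * x"
        using q(3) by blast
      with m(1) show ?thesis
        by (auto intro!: image_eqI[of _ _ x])
    qed
    with q z show ?case
      by (intro exI[of _ "4 * z * q"]) auto
  qed
  obtain a b where ab: "a < b" "j a = j b"
    using finite_range_repeats[of I j] B(2) \<open>finite I\<close> by blast
  then obtain n where n: "b = Suc (a + n)"
    using less_natE by blast
  obtain q where q: "q > 0" "p (a + n) = q * p a" "B (a + n) \<subseteq> (*) q ` B a"
    using descend[where a = a and n = n] by blast
  obtain z where z: "z > 0" "\<And>t. t \<in> B b \<Longrightarrow>
      \<exists>m. t = 4 * z * m \<and> (\<forall>c. \<bar>c\<bar> \<le> (p (a + n))\<^sup>2 \<longrightarrow> m + c * z \<in> B (a + n))"
    using next_step[of "a + n"] unfolding n by blast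
  have "B b \<noteq> {}"
    using B(1)[of b] large_empty by metis
  then obtain t where t: "t \<in> B b"
    by blast
  then obtain m where m: "t = 4 * z * m"
      "\<And>c. \<bar>c\<bar> \<le> (p (a + n))\<^sup>2 \<Longrightarrow> m + c * z \<in> B (a + n)"
    using z(2) by blast
  have "q \<le> p (a + n)"
    using q(1,2) B(4)[of a] by (simp add: mult_le_cancel_left1 int_one_le_iff_zero_less)
  then have c: "q\<^sup>2 \<le> (p (a + n))\<^sup>2"
    using q(1) by (intro power_mono) auto
  \<comment> \<open>Division by \<open>q\<close> turns \<open>m\<close> into \<open>x\<close> and a step \<open>q\<^sup>2 * z\<close> into
    \<open>q * z = y\<close>, while \<open>t = 4 * z * m = 4 * x * y\<close>; hence the coefficients \<open>\<plusminus>q\<^sup>2\<close>.\<close>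
  have "m \<in> B (a + n)" "m + q\<^sup>2 * z \<in> B (a + n)" "m - q\<^sup>2 * z \<in> B (a + n)"
    using c m(2)[of 0] m(2)[of "q\<^sup>2"] m(2)[of "- (q\<^sup>2)"] by simp_all
  with q(3) have "m \<in> (*) q ` B a" "m + q\<^sup>2 * z \<in> (*) q ` B a" "m - q\<^sup>2 * z \<in> (*) q ` B a"
    by blast+
  then obtain x x\<^sub>1 x\<^sub>2 where x: "m = q * x" "m + q\<^sup>2 * z = q * x\<^sub>1" "m - q\<^sup>2 * z = q * x\<^sub>2"
      "x\<^sub>1 \<in> B a" "x\<^sub>2 \<in> B a"
    by blast
  define y where "y = q * z"
  have "q * x\<^sub>1 = q * (x + y)" "q * x\<^sub>2 = q * (x - y)"
    using x(1-3) unfolding y_def by (simp_all add: algebra_simps power2_eq_square)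
  then have "x + y \<in> B a" "x - y \<in> B a"
    using q(1) x(4,5) by auto
  moreover have "4 * x * y = t"
    unfolding m(1) x(1) y_def by simp
  ultimately show ?thesis
    using t B(2,3)[of a] B(3)[of b] ab(2) by (metis subsetD)
qed

theorem corollary1p8:
  fixes C :: "nat \<Rightarrow> nat set" and r :: nat
  assumes "disjoint_family_on C {1..r}"
    and "(\<Union>i\<in>{1..r}. C i) = {1..}"
  shows "\<exists>i\<in>{1..r}. \<exists>a\<in>C i. \<exists>b\<in>C i. \<exists>c\<in>C i. (int a)\<^sup>2 - (int b)\<^sup>2 = int c"
proof -
  have "(\<Union>i\<in>{1..r}. int ` C i) = int ` {1..}"
    using assms(2) by blast
  also have "\<dots> = {1..}"
  proof
    show "int ` {1..} \<subseteq> {1..}"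
      by auto
    show "{1..} \<subseteq> int ` {1..}"
      by (auto intro!: image_eqI[of _ _ "nat _"])
  qed
  finally have "(\<Union>i\<in>{1..r}. int ` C i) = {1..}" .
  from monochromatic_sum_difference_product[OF _ this] obtain i x y where i: "i \<in> {1..r}"
      and xy: "x + y \<in> int ` C i" "x - y \<in> int ` C i" "4 * x * y \<in> int ` C i"
    by blast
  obtain a b c where abc: "a \<in> C i" "b \<in> C i" "c \<in> C i"
      "x + y = int a" "x - y = int b" "4 * x * y = int c"
    using xy by blast
  have "(x + y)\<^sup>2 - (x - y)\<^sup>2 = 4 * x * y"
    by (simp add: power2_eq_square algebra_simps)
  then show ?thesis
    using i abc by metis
qed

end
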